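(* We have $7/50 \in \mathcal{S}^*_0(2) \setminus \mathcal{S}_1(3)$.
   Context: "Subgroup" of $(\mathbb{R}/\mathbb{Z})^n$ always means closed subgroup. A $1$-dimensional subtorus of $(\mathbb{R}/\mathbb{Z})^n$ is the image $\{t(v_1,\ldots,v_n): t\in\mathbb{R}\}$ mod $\mathbb{Z}^n$ of a line through the origin spanned by a nonzero integer vector $(v_1,\ldots,v_n)$; a $0$-dimensional subgroup is a finite subgroup. For a closed subset $X \subseteq (\mathbb{R}/\mathbb{Z})^n$, $D(X)$ is the $L^\infty$-distance from $X$ to $(1/2,\ldots,1/2)$: $D(X)=\inf_{x\in X}\max_{i}\|x_i-1/2\|_{\mathbb{R}/\mathbb{Z}}$, where $\|y\|_{\mathbb{R}/\mathbb{Z}}$ is the distance from $y$ to the nearest integer. $X$ is proper if it is not contained in the union of the coordinate hyperplanes $\{x_i=0\}$, $1\le i\le n$. $\mathcal{S}^*_0(2)$ is the set of values $D(\Delta)$ as $\Delta$ ranges over the $0$-dimensional (finite) proper subgroups of $(\mathbb{R}/\mathbb{Z})^2$. $\mathcal{S}_1(3)$ is the set of values $D(T)$ as $T$ ranges over the $1$-dimensional proper subtori of $(\mathbb{R}/\mathbb{Z})^3$. *)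

theory Defs
  imports "HOL-Analysis.Analysis" "HOL-Algebra.Group"
begin

text \<open>The circle group \<open>\<real>/\<int>\<close>. The torus \<open>(\<real>/\<int>)\<^sup>n\<close> is the type \<open>circle ^ 'n\<close>
  with \<open>CARD('n) = n\<close>, whose group structure is the library's componentwise one.\<close>

quotient_type circle = real / "\<lambda>x y :: real. x - y \<in> \<int>"
proof (rule equivpI)
  show "reflp (\<lambda>x y :: real. x - y \<in> \<int>)"
    by (simp add: reflp_def)
  show "symp (\<lambda>x y :: real. x - y \<in> \<int>)"
    by (auto simp: symp_def intro: Ints_minus [of "_ - _", simplified])
  show "transp (\<lambda>x y :: real. x - y \<in> \<int>)"
  proof (rule transpI)
    fix x y z :: real
    assume "x - y \<in> \<int>" "y - z \<in> \<int>"
    from Ints_add [OF this] show "x - z \<in> \<int>" by simp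
  qed
qed

lift_definition to_circle :: "real \<Rightarrow> circle" is "\<lambda>x. x" .

instantiation circle :: ab_group_add
begin

lift_definition zero_circle :: circle is "0 :: real" .

lift_definition plus_circle :: "circle \<Rightarrow> circle \<Rightarrow> circle" is "(+)"
proof -
  fix a b c d :: real
  assume "a - b \<in> \<int>" "c - d \<in> \<int>"
  from Ints_add [OF this] show "a + c - (b + d) \<in> \<int>"
    by (simp add: algebra_simps)
qed

lift_definition uminus_circle :: "circle \<Rightarrow> circle" is uminus
proof -
  fix a b :: real
  assume "a - b \<in> \<int>"
  from Ints_minus [OF this] show "- a - - b \<in> \<int>" by simp
qed

lift_definition minus_circle :: "circle \<Rightarrow> circle \<Rightarrow> circle" is "(-)"
proof -
  fix a b c d :: real
  assume "a - b \<in> \<int>" "c - d \<in> \<int>"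
  from Ints_diff [OF this] show "a - c - (b - d) \<in> \<int>"
    by (simp add: algebra_simps)
qed

instance
  by standard (transfer, simp)+

end

lemma abs_diff_round_cong:
  fixes x y :: real
  assumes "x - y \<in> \<int>"
  shows "\<bar>x - of_int (round x)\<bar> = \<bar>y - of_int (round y)\<bar>"
proof -
  from assms obtain n where "x - y = of_int n"
    by (auto elim: Ints_cases)
  then have x: "x = y + of_int n" by simp
  have "round x = round y + n"
    unfolding x round_def by (metis add.assoc add.commute floor_add_int)
  then show ?thesis
    unfolding x by simp
qed

text \<open>The distance from \<open>y\<close> to the nearest integer.\<close>

lift_definition circle_norm :: "circle \<Rightarrow> real" is "\<lambda>y. \<bar>y - of_int (round y)\<bar>"
  by (rule abs_diff_round_cong)

lemma circle_norm_eq_0_iff: "circle_norm x = 0 \<longleftrightarrow> x = 0"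
proof transfer
  fix x :: real
  show "\<bar>x - of_int (round x)\<bar> = 0 \<longleftrightarrow> x - 0 \<in> \<int>"
    by (metis Ints_cases Ints_of_int abs_0_eq abs_eq_0 diff_zero eq_iff_diff_eq_0 round_of_int)
qed

lemma circle_norm_diff_triangle:
  "circle_norm (x - y) \<le> circle_norm (x - z) + circle_norm (y - z)"
proof transfer
  fix x y z :: real
  have "\<bar>(x - y) - of_int (round (x - y))\<bar>
      \<le> \<bar>(x - y) - of_int (round (x - z) - round (y - z))\<bar>"
    by (rule round_diff_minimal)
  also have "\<dots> \<le> \<bar>x - z - of_int (round (x - z))\<bar> + \<bar>y - z - of_int (round (y - z))\<bar>"
    by simp
  finally show "\<bar>x - y - of_int (round (x - y))\<bar>
      \<le> \<bar>x - z - of_int (round (x - z))\<bar> + \<bar>y - z - of_int (round (y - z))\<bar>" .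
qed

instantiation circle :: metric_space
begin

definition dist_circle :: "circle \<Rightarrow> circle \<Rightarrow> real"
  where "dist_circle x y = circle_norm (x - y)"

definition uniformity_circle :: "(circle \<times> circle) filter"
  where "uniformity_circle = (INF e\<in>{0<..}. principal {(x, y). dist x y < e})"

definition open_circle :: "circle set \<Rightarrow> bool"
  where "open_circle U \<longleftrightarrow>
    (\<forall>x\<in>U. eventually (\<lambda>(x', y). x' = x \<longrightarrow> y \<in> U) uniformity)"

instance
proof
  fix x y z :: circle and U :: "circle set"
  show "dist x y = 0 \<longleftrightarrow> x = y"
    by (simp add: dist_circle_def circle_norm_eq_0_iff)
  show "dist x y \<le> dist x z + dist y z"
    unfolding dist_circle_def by (rule circle_norm_diff_triangle)
  show "(uniformity :: (circle \<times> circle) filter) =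
      (INF e\<in>{0<..}. principal {(x, y). dist x y < e})"
    by (rule uniformity_circle_def)
  show "open U \<longleftrightarrow> (\<forall>x\<in>U. \<forall>\<^sub>F (x', y) in uniformity. x' = x \<longrightarrow> y \<in> U)"
    by (rule open_circle_def)
qed

end

definition torus_group :: "(circle ^ 'n) monoid"
  where "torus_group = \<lparr>carrier = UNIV, mult = (+), one = 0\<rparr>"

definition finite_subgroup :: "(circle ^ 'n) set \<Rightarrow> bool"
  where "finite_subgroup H \<longleftrightarrow> subgroup H torus_group \<and> closed H \<and> finite H"

definition one_dim_subtorus :: "(circle ^ 'n) set \<Rightarrow> bool"
  where "one_dim_subtorus T \<longleftrightarrow>
    (\<exists>v :: int ^ 'n. v \<noteq> 0 \<and> T = range (\<lambda>t :: real. \<chi> i. to_circle (t * of_int (v $ i))))"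

definition proper :: "(circle ^ 'n) set \<Rightarrow> bool"
  where "proper X \<longleftrightarrow> \<not> X \<subseteq> (\<Union>i. {x. x $ i = 0})"

text \<open>Applied to proper, hence nonempty, sets only, so the infimum is a genuine one.\<close>

definition D :: "(circle ^ 'n) set \<Rightarrow> real"
  where "D X = (INF x\<in>X. Max (range (\<lambda>i. circle_norm (x $ i - to_circle (1/2)))))"

text \<open>\<open>S0_star TYPE('n)\<close> is \<open>\<S>\<^sup>*\<^sub>0(n)\<close> and \<open>S1 TYPE('n)\<close> is \<open>\<S>\<^sub>1(n)\<close>, where
  \<open>n = CARD('n)\<close>.\<close>

definition S0_star :: "'n::finite itself \<Rightarrow> real set"
  where "S0_star _ = {D \<Delta> | \<Delta> :: (circle ^ 'n) set. finite_subgroup \<Delta> \<and> proper \<Delta>}"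

definition S1 :: "'n::finite itself \<Rightarrow> real set"
  where "S1 _ = {D T | T :: (circle ^ 'n) set. one_dim_subtorus T \<and> proper T}"

end

theory Submission
  imports Defs
begin

text \<open>
  Write \<open>h x\<close> for the distance from \<open>x - 1/2\<close> to the nearest integer.

  Membership in \<open>\<S>\<^sup>*\<^sub>0(2)\<close> is witnessed by the cyclic group of order 25 generated by
  \<open>(1/25, 7/25)\<close>: its ninth multiple \<open>(9/25, 13/25)\<close> is at distance \<open>7/50\<close> from the centre, and
  no \<open>k\<close> makes both \<open>k\<close> and \<open>7 k\<close> lie in \<open>{10..15}\<close> modulo 25.

  For the other half, let \<open>T\<close> be the subtorus of direction \<open>v \<in> \<int>\<^sup>3\<close>, and suppose that
  \<open>D T = 7/50\<close>. Properness means that all \<open>v\<^sub>i\<close> are nonzero. By periodicity and compactness some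
  time \<open>t\<close> attains the infimum. The key principle (\<open>improve_single_coordinate\<close>) is that no time
  can have all but one of the \<open>h (t v\<^sub>i)\<close> below \<open>7/50\<close> and the remaining one at most \<open>7/50\<close>:
  moving \<open>t\<close> slightly would pull that coordinate towards \<open>1/2\<close>, because \<open>v\<^sub>i \<noteq> 0\<close>, without
  spoiling the others. So at the minimiser at least two coordinates have
  \<open>h = 7/50\<close>, that is, they equal \<open>\<plusminus>9/25\<close> modulo 1, and the third one, \<open>z\<close>, lies in the arc
  \<open>[9/25, 16/25]\<close>.

  Since \<open>T\<close> is a group, multiples \<open>j t\<close> are also available. For \<open>j\<close> in \<open>{4, 7, 10, 15, 18, 29}\<close>
  the number \<open>9 j\<close> is in \<open>{10..15}\<close> modulo 25, so the first two coordinates move strictly inside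
  the arc, and for each \<open>z\<close> in the arc one of these \<open>j\<close> keeps \<open>j z\<close> in the arc
  (\<open>multiple_back_to_arc\<close>). At the time \<open>j t\<close> only one coordinate can be at distance \<open>7/50\<close>,
  which contradicts the principle above.
\<close>

section \<open>The distance to one half\<close>

definition half_dist :: "real \<Rightarrow> real"
  where "half_dist x = circle_norm (to_circle x - to_circle (1/2))"

lemma half_dist_eq_round: "half_dist x = \<bar>x - 1/2 - of_int (round (x - 1/2))\<bar>"
  unfolding half_dist_def by transfer simp

lemma half_dist_le_abs: "half_dist x \<le> \<bar>x - 1/2 - of_int n\<bar>"
  unfolding half_dist_eq_round by (rule round_diff_minimal)

lemma obtain_half_dist:
  obtains n :: int where "half_dist x = \<bar>x - 1/2 - of_int n\<bar>"
  using half_dist_eq_round by blast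

lemma half_dist_less_iff: "half_dist x < c \<longleftrightarrow> (\<exists>n::int. \<bar>x - 1/2 - of_int n\<bar> < c)"
  using half_dist_le_abs half_dist_eq_round by (metis order_le_less_trans)

lemma half_dist_le_iff: "half_dist x \<le> c \<longleftrightarrow> (\<exists>n::int. \<bar>x - 1/2 - of_int n\<bar> \<le> c)"
  using half_dist_le_abs half_dist_eq_round by (metis order_trans)

lemma half_dist_add_int [simp]: "half_dist (x + of_int n) = half_dist x"
proof -
  have "to_circle (x + of_int n) = to_circle x"
    by transfer simp
  then show ?thesis
    by (simp add: half_dist_def)
qed

lemma half_dist_le_add: "half_dist x \<le> half_dist y + \<bar>x - y\<bar>"
proof -
  obtain n :: int where "half_dist y = \<bar>y - 1/2 - of_int n\<bar>"
    by (rule obtain_half_dist)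
  with half_dist_le_abs [of x n] show ?thesis
    by linarith
qed

lemma continuous_on_half_dist: "continuous_on UNIV half_dist"
proof (rule continuous_onI)
  fix x e :: real
  assume "e > 0"
  moreover have "dist (half_dist y) (half_dist x) \<le> dist y x" for y
    using half_dist_le_add [of x y] half_dist_le_add [of y x] by (simp add: dist_real_def)
  ultimately show "\<exists>d>0. \<forall>y\<in>UNIV. dist y x < d \<longrightarrow> dist (half_dist y) (half_dist x) \<le> e"
    by (meson less_imp_le order_trans)
qed

section \<open>A cyclic group of order 25\<close>

definition cyclic25 :: "(circle ^ 2) set"
  where "cyclic25 = range (\<lambda>k::int. \<chi> i. to_circle (of_int (k * (if i = 1 then 1 else 7)) / 25))"

text \<open>The first coordinate \<open>k/25\<close> is within less than \<open>7/50\<close> of \<open>1/2\<close> exactly when \<open>k\<close> is in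
  \<open>{10..15}\<close> modulo 25, and then \<open>7 k\<close> modulo 25 is one of 20, 2, 9, 16, 23, 5.\<close>

lemma cyclic25_far_from_half:
  "7/50 \<le> half_dist (of_int k / 25) \<or> 7/50 \<le> half_dist (of_int (7 * k) / 25)"
proof (rule ccontr)
  assume "\<not> ?thesis"
  then have "half_dist (of_int k / 25) < 7/50" "half_dist (of_int (7 * k) / 25) < 7/50"
    by linarith+
  then obtain m n :: int
    where "\<bar>of_int k / 25 - 1/2 - of_int m\<bar> < (7/50 :: real)"
      and "\<bar>of_int (7 * k) / 25 - 1/2 - of_int n\<bar> < (7/50 :: real)"
    unfolding half_dist_less_iff by blast
  then have "of_int (9 + 25 * m) < (of_int k :: real)" "of_int k < (of_int (16 + 25 * m) :: real)"
    and "of_int (9 + 25 * n) < (of_int (7 * k) :: real)"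
        "of_int (7 * k) < (of_int (16 + 25 * n) :: real)"
    by (simp_all add: abs_less_iff field_simps)
  then have k: "9 + 25 * m < k" "k < 16 + 25 * m" and k7: "9 + 25 * n < 7 * k" "7 * k < 16 + 25 * n"
    by (simp_all only: of_int_less_iff)
  from k consider "k = 10 + 25 * m" | "k = 11 + 25 * m" | "k = 12 + 25 * m"
    | "k = 13 + 25 * m" | "k = 14 + 25 * m" | "k = 15 + 25 * m"
    by linarith
  moreover define u where "u = n - 7 * m"
  with k7 have "9 + 25 * u < 7 * (k - 25 * m)" "7 * (k - 25 * m) < 16 + 25 * u"
    by simp_all
  ultimately show False
    by cases (simp; presburger)+
qed

lemma finite_subgroup_cyclic25: "finite_subgroup cyclic25"
proof -
  define g :: "int \<Rightarrow> circle ^ 2"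
    where "g k = (\<chi> i. to_circle (of_int (k * (if i = 1 then 1 else 7)) / 25))" for k
  have G: "cyclic25 = range g"
    by (simp add: cyclic25_def g_def [abs_def])
  have g_add: "g k + g l = g (k + l)" for k l
  proof -
    have "to_circle x + to_circle y = to_circle (x + y)" for x y
      by transfer simp
    then show ?thesis
      by (simp add: g_def vec_eq_iff add_divide_distrib algebra_simps)
  qed
  have g_0: "g 0 = 0"
    by (simp add: g_def vec_eq_iff) (transfer, simp)
  have g_minus: "g k + g (- k) = 0" "g (- k) + g k = 0" for k
    by (simp_all add: g_add g_0)
  have "g k = g (k mod 25)" for k
  proof -
    have "to_circle (of_int (k * c) / 25) = to_circle (of_int (k mod 25 * c) / 25)" for c :: int
    proof transfer
      fix k c :: int
      have "k = k mod 25 + 25 * (k div 25)"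
        by simp
      then have "of_int k = (of_int (k mod 25) + 25 * of_int (k div 25) :: real)"
        by (metis of_int_add of_int_mult of_int_numeral)
      then have "of_int (k * c) / 25 - of_int (k mod 25 * c) / 25 = (of_int (k div 25 * c) :: real)"
        by (simp add: field_simps)
      then show "of_int (k * c) / 25 - of_int (k mod 25 * c) / 25 \<in> (\<int> :: real set)"
        by (metis Ints_of_int)
    qed
    then show ?thesis
      unfolding g_def vec_eq_iff vec_lambda_beta by blast
  qed
  then have "range g \<subseteq> g ` {0..<25}"
    by (metis (mono_tags, lifting) atLeastLessThan_iff image_eqI image_subsetI
        pos_mod_bound pos_mod_sign zero_less_numeral)
  then have fin: "finite (range g)"
    by (rule finite_subset) simp
  interpret torus: group "torus_group :: (circle ^ 2) monoid"
    by (rule groupI)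
      (auto simp: torus_group_def add.assoc intro: exI [of _ "- _"] ab_left_minus)
  have "subgroup (range g) torus_group"
  proof (rule torus.subgroupI)
    fix a
    assume "a \<in> range g"
    then obtain k where k: "a = g k"
      by blast
    have "inv\<^bsub>torus_group\<^esub> a = g (- k)"
      by (rule torus.inv_equality) (simp_all add: torus_group_def k g_minus)
    then show "inv\<^bsub>torus_group\<^esub> a \<in> range g"
      by simp
  qed (auto simp: torus_group_def g_add)
  with fin show ?thesis
    by (simp add: finite_subgroup_def G finite_imp_closed)
qed

lemma proper_cyclic25: "proper cyclic25"
proof -
  have nonzero: "to_circle (of_int m / 25) \<noteq> 0" if "m mod 25 \<noteq> 0" for m :: int
    using that
  proof transfer
    fix m :: int
    assume m: "m mod 25 \<noteq> 0"
    show "of_int m / 25 - 0 \<notin> (\<int> :: real set)"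
    proof
      assume "of_int m / 25 - 0 \<in> (\<int> :: real set)"
      then obtain n :: int where "of_int m / 25 = (of_int n :: real)"
        by (auto elim: Ints_cases)
      then have "of_int m = (of_int (25 * n) :: real)"
        by (simp add: field_simps)
      then have "m = 25 * n"
        by (simp only: of_int_eq_iff)
      with m show False
        by simp
    qed
  qed
  let ?x = "\<chi> i::2. to_circle (of_int (1 * (if i = 1 then 1 else 7)) / 25)"
  have "?x \<in> cyclic25"
    unfolding cyclic25_def by (rule rangeI)
  moreover have "?x $ i \<noteq> 0" for i
    using nonzero [of 1] nonzero [of 7] by simp
  ultimately show ?thesis
    unfolding proper_def by blast
qed

lemma D_cyclic25: "D cyclic25 = 7/50"
proof -
  define f where "f k = max (half_dist (of_int k / 25)) (half_dist (of_int (7 * k) / 25))" for k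
  have "D cyclic25 = Inf (range f)"
    by (simp add: D_def cyclic25_def image_image half_dist_def f_def UNIV_2 mult.commute)
  also have "\<dots> = 7/50"
  proof (rule cInf_eq_minimum)
    have "half_dist (of_int 9 / 25) \<le> 7/50" "half_dist (of_int (7 * 9) / 25) \<le> 7/50"
      using half_dist_le_abs [of "of_int 9 / 25" 0] half_dist_le_abs [of "of_int (7 * 9) / 25" 2]
      by simp_all
    then have "f 9 = 7/50"
      using cyclic25_far_from_half [of 9] unfolding f_def by linarith
    then show "7/50 \<in> range f"
      by (metis rangeI)
    fix x
    assume "x \<in> range f"
    then obtain k where "x = f k"
      by blast
    then show "7/50 \<le> x"
      using cyclic25_far_from_half [of k] unfolding f_def by linarith
  qed
  finally show ?thesis .
qed

section \<open>Minimising times of a one-dimensional subtorus\<close>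

lemma continuous_on_Max_range:
  fixes f :: "'i::finite \<Rightarrow> 'a::topological_space \<Rightarrow> real"
  assumes "\<And>i. continuous_on S (f i)"
  shows "continuous_on S (\<lambda>x. Max (range (\<lambda>i. f i x)))"
proof -
  have "continuous_on S (\<lambda>x. Max ((\<lambda>i. f i x) ` I))" if "finite I" "I \<noteq> {}" for I
    using that
  proof (induction I rule: finite_ne_induct)
    case (singleton i)
    then show ?case
      using assms by simp
  next
    case (insert i I)
    then show ?case
      using assms by (simp add: continuous_on_max)
  qed
  then show ?thesis
    by simp
qed

text \<open>The coordinates have period 1 in the time, so the infimum is one over \<open>[0, 1]\<close>, where
  compactness provides a minimiser.\<close>

lemma obtain_minimising_time:
  fixes v :: "int ^ 'n"
  defines "T \<equiv> range (\<lambda>t::real. \<chi> i. to_circle (t * of_int (v $ i)))"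
  obtains t :: real where "D T = Max (range (\<lambda>i. half_dist (t * v $ i)))"
    and "\<And>s::real. D T \<le> Max (range (\<lambda>i. half_dist (s * v $ i)))"
proof -
  define f where "f t = Max (range (\<lambda>i. half_dist (t * v $ i)))" for t :: real
  have D_eq: "D T = Inf (range f)"
    by (simp add: D_def T_def image_image half_dist_def f_def)
  have "continuous_on UNIV f"
    unfolding f_def
    by (intro continuous_on_Max_range continuous_on_compose2 [OF continuous_on_half_dist]
        continuous_intros) auto
  then have "continuous_on {0..1} f"
    by (rule continuous_on_subset) simp
  then obtain t where t: "\<forall>s\<in>{0..1}. f t \<le> f s"
    using continuous_attains_inf [of "{0..1}" f] by fastforce
  have "f t \<le> f s" for s
  proof -
    have "half_dist (s * v $ i) = half_dist (frac s * v $ i)" for i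
    proof -
      have "s * v $ i = frac s * v $ i + of_int (\<lfloor>s\<rfloor> * v $ i)"
        by (simp add: frac_def algebra_simps)
      then show ?thesis
        by (simp only: half_dist_add_int)
    qed
    then have "f s = f (frac s)"
      by (simp add: f_def)
    with t show ?thesis
      by (simp add: frac_lt_1 less_imp_le)
  qed
  moreover from this have "D T = f t"
    unfolding D_eq by (intro cInf_eq_minimum) auto
  ultimately show thesis
    using that unfolding f_def by metis
qed

section \<open>Improving a time\<close>

text \<open>If \<open>d\<close> is the signed distance of \<open>t v\<^sub>i\<close> from its nearest half-integer, then replacing \<open>t\<close>
  by \<open>t - e d v\<^sub>i\<close> multiplies \<open>d\<close> by \<open>1 - e v\<^sub>i\<^sup>2\<close>, and for small positive \<open>e\<close> the strict
  inequalities for the other coordinates survive.\<close>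

lemma improve_single_coordinate:
  fixes v :: "int ^ 'n" and t c :: real
  assumes "v $ i \<noteq> 0" and "0 < c"
    and le: "half_dist (t * v $ i) \<le> c"
    and less: "\<And>k. k \<noteq> i \<Longrightarrow> half_dist (t * v $ k) < c"
  obtains s :: real where "\<And>k. half_dist (s * v $ k) < c"
proof -
  define w where "w = real_of_int (v $ i)"
  have "w \<noteq> 0"
    using assms(1) by (simp add: w_def)
  then have w2: "0 < w\<^sup>2"
    by simp
  from le obtain n :: int where "\<bar>t * w - 1/2 - of_int n\<bar> \<le> c"
    unfolding half_dist_le_iff w_def by blast
  define d where "d = t * w - 1/2 - of_int n"
  have d: "\<bar>d\<bar> \<le> c"
    unfolding d_def by fact
  define s where "s e = t - e * (d * w)" for e
  have "\<forall>\<^sub>F e in at_right 0. half_dist (s e * v $ k) < c" if "k \<noteq> i" for k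
  proof (rule order_tendstoD(2))
    have "((\<lambda>e. s e * v $ k) \<longlongrightarrow> (t - 0 * (d * w)) * v $ k) (at_right 0)"
      unfolding s_def by (intro tendsto_intros)
    then show "((\<lambda>e. half_dist (s e * v $ k)) \<longlongrightarrow> half_dist (t * v $ k)) (at_right 0)"
      by (intro continuous_on_tendsto_compose [OF continuous_on_half_dist]) simp_all
  qed (rule less [OF that])
  moreover have "\<forall>\<^sub>F e in at_right 0. half_dist (s e * v $ i) < c"
  proof -
    have "half_dist (s e * v $ i) < c" if "0 < e" "e < 1 / w\<^sup>2" for e
    proof -
      have "0 < e * w\<^sup>2" "e * w\<^sup>2 < 1"
        using that w2 by (simp_all add: field_simps)
      then have "\<bar>d\<bar> * \<bar>1 - e * w\<^sup>2\<bar> < c"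
        using d \<open>0 < c\<close> by (cases "d = 0") (auto intro!: less_le_trans [OF _ d])
      moreover have "s e * v $ i - 1/2 - of_int n = d * (1 - e * w\<^sup>2)"
        by (simp add: s_def d_def w_def power2_eq_square algebra_simps)
      ultimately show ?thesis
        using half_dist_le_abs [of "s e * v $ i" n] by (simp add: abs_mult)
    qed
    then show ?thesis
      unfolding eventually_at_right_field using w2 by (intro exI [of _ "1 / w\<^sup>2"]) simp
  qed
  ultimately have "\<forall>\<^sub>F e in at_right 0. half_dist (s e * v $ k) < c" for k
    by (cases "k = i") simp_all
  then have "\<forall>\<^sub>F e in at_right 0. \<forall>k. half_dist (s e * v $ k) < c"
    by (rule eventually_all_finite)
  then obtain e where "\<forall>k. half_dist (s e * v $ k) < c"
    using eventually_happens' trivial_limit_at_right_real by blast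
  then show thesis
    using that by blast
qed

section \<open>Multiples of a time\<close>

lemma half_dist_uminus: "half_dist (- x) = half_dist x"
proof -
  have "half_dist (- x) \<le> half_dist x" for x
  proof -
    obtain n :: int where "half_dist x = \<bar>x - 1/2 - of_int n\<bar>"
      by (rule obtain_half_dist)
    with half_dist_le_abs [of "- x" "- n - 1"] show ?thesis
      by simp
  qed
  from this [of x] this [of "- x"] show ?thesis
    by simp
qed

text \<open>The multipliers for which \<open>9 j\<close> modulo 25 is in \<open>{10..15}\<close>; multiplication by them brings
  \<open>\<plusminus>9/25\<close> strictly closer to \<open>1/2\<close>.\<close>

definition multipliers :: "int set"
  where "multipliers = {4, 7, 10, 15, 18, 29}"

lemma multiple_strictly_inside_arc:
  assumes "half_dist x = 7/50" and "j \<in> multipliers"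
  shows "half_dist (of_int j * x) < 7/50"
proof -
  have plus: "half_dist (of_int j * (9/25 + of_int n)) < 7/50" for n
  proof -
    have "half_dist (of_int j * (9/25)) < 7/50"
      using assms(2) half_dist_le_abs [of "36/25" 1] half_dist_le_abs [of "63/25" 2]
        half_dist_le_abs [of "18/5" 3] half_dist_le_abs [of "27/5" 5]
        half_dist_le_abs [of "162/25" 6] half_dist_le_abs [of "261/25" 10]
      by (auto simp: multipliers_def)
    moreover have "half_dist (of_int j * (9/25 + of_int n)) =
        half_dist (of_int j * (9/25) + of_int (j * n))"
      by (simp add: algebra_simps)
    ultimately show ?thesis
      by (simp only: half_dist_add_int)
  qed
  obtain n :: int where "half_dist x = \<bar>x - 1/2 - of_int n\<bar>"
    by (rule obtain_half_dist)
  with assms(1) have "x - 1/2 - of_int n = - (7/50) \<or> x - 1/2 - of_int n = 7/50"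
    by linarith
  then consider "x = 9/25 + of_int n" | "- x = 9/25 + of_int (- n - 1)"
    by force
  then show ?thesis
  proof cases
    case 1
    with plus show ?thesis
      by simp
  next
    case 2
    with plus [of "- n - 1"] half_dist_uminus [of "of_int j * x"] show ?thesis
      by (metis mult_minus_right)
  qed
qed

text \<open>By the symmetry \<open>z \<mapsto> -z\<close> it suffices to treat \<open>z\<close> in \<open>[9/25, 1/2]\<close>. The \<open>z\<close> for
  which \<open>j z\<close> lies in \<open>[m + 9/25, m + 16/25]\<close> form an interval; for the pairs \<open>(j, m)\<close> used
  below these intervals cover \<open>[9/25, 1/2]\<close>. The multiplier 29 fills the short gap between
  \<open>58/125\<close>, where the interval of \<open>(10, 4)\<close> ends, and \<open>209/450\<close>, where that of \<open>(18, 8)\<close>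
  starts.\<close>

lemma multiple_back_to_arc:
  assumes "half_dist z \<le> 7/50"
  obtains j where "j \<in> multipliers" and "half_dist (of_int j * z) \<le> 7/50"
proof -
  have lower_half: "\<exists>j\<in>multipliers. half_dist (of_int j * (y + of_int n)) \<le> 7/50"
    if y: "9/25 \<le> y" "y \<le> 1/2" for y :: real and n :: int
  proof -
    have *: "\<exists>j\<in>multipliers. half_dist (of_int j * (y + of_int n)) \<le> 7/50"
      if "j \<in> multipliers" "of_int m + 9/25 \<le> of_int j * y" "of_int j * y \<le> of_int m + 16/25"
      for j m
    proof -
      have "\<bar>of_int j * y - 1/2 - of_int m\<bar> \<le> 7/50"
        using that by linarith
      then have *: "half_dist (of_int j * y) \<le> 7/50"
        using half_dist_le_iff by blast
      have "of_int j * (y + of_int n) = of_int j * y + of_int (j * n)"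
        by (simp add: algebra_simps)
      then have "half_dist (of_int j * (y + of_int n)) = half_dist (of_int j * y)"
        by (simp only: half_dist_add_int)
      also have "\<dots> \<le> 7/50"
        by (rule *)
      finally show ?thesis
        using that(1) by blast
    qed
    consider "y \<le> 41/100" | "41/100 < y" "y \<le> 424/1000" | "424/1000 < y" "y \<le> 44/100"
      | "44/100 < y" "y \<le> 464/1000" | "464/1000 < y" "y \<le> 47/100"
      | "47/100 < y" "y \<le> 48/100" | "48/100 < y"
      by linarith
    then show ?thesis
    proof cases
      case 1
      with y show ?thesis
        by (intro * [of 4 1]) (simp_all add: multipliers_def)
    next
      case 2
      then show ?thesis
        by (intro * [of 18 7]) (simp_all add: multipliers_def)
    next
      case 3
      then show ?thesis
        by (intro * [of 15 6]) (simp_all add: multipliers_def)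
    next
      case 4
      then show ?thesis
        by (intro * [of 10 4]) (simp_all add: multipliers_def)
    next
      case 5
      then show ?thesis
        by (intro * [of 29 13]) (simp_all add: multipliers_def)
    next
      case 6
      then show ?thesis
        by (intro * [of 18 8]) (simp_all add: multipliers_def)
    next
      case 7
      with y show ?thesis
        by (intro * [of 7 3]) (simp_all add: multipliers_def)
    qed
  qed
  obtain n :: int where n: "\<bar>z - 1/2 - of_int n\<bar> \<le> 7/50"
    using assms half_dist_le_iff by blast
  have "\<exists>j\<in>multipliers. half_dist (of_int j * z) \<le> 7/50"
  proof (cases "z - of_int n \<le> 1/2")
    case True
    with n lower_half [of "z - of_int n" n] show ?thesis
      by (simp add: abs_le_iff)
  next
    case False
    with n lower_half [of "of_int (n + 1) - z" "- n - 1"] show ?thesis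
      by (simp add: abs_le_iff half_dist_uminus)
  qed
  then show thesis
    using that by blast
qed

section \<open>Seven fiftieths as a distance\<close>

lemma seven_fiftieths_in_S0_star_2: "7/50 \<in> S0_star TYPE(2)"
  unfolding S0_star_def
  using finite_subgroup_cyclic25 proper_cyclic25 D_cyclic25 by force

text \<open>Two extremal coordinates are forced by \<open>improve_single_coordinate\<close>; passing to a multiple of
  the time leaves at most one of them.\<close>

lemma no_extremal_time:
  fixes v :: "int ^ 3" and t :: real
  assumes nonzero: "\<And>k. v $ k \<noteq> 0"
    and at_most: "\<And>k. half_dist (t * v $ k) \<le> 7/50"
    and minimal: "\<And>s::real. \<exists>k. 7/50 \<le> half_dist (s * v $ k)"
  shows False
proof -
  have two_extremal: "\<exists>k. k \<noteq> i \<and> 7/50 \<le> half_dist (s * v $ k)"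
    if "half_dist (s * v $ i) \<le> 7/50" for s :: real and i
  proof (rule ccontr)
    assume "\<not> ?thesis"
    then have "\<And>k. k \<noteq> i \<Longrightarrow> half_dist (s * v $ k) < 7/50"
      by (meson not_le)
    from improve_single_coordinate [OF nonzero _ that this]
    obtain s' :: real where "\<And>k. half_dist (s' * v $ k) < 7/50"
      by auto
    with minimal [of s'] show False
      by (meson not_le)
  qed
  obtain i where i: "half_dist (t * v $ i) = 7/50"
    using minimal [of t] at_most by (meson order_antisym)
  obtain k where "k \<noteq> i" and k: "half_dist (t * v $ k) = 7/50"
    using two_extremal [OF at_most] at_most by (meson order_antisym)
  obtain l where l: "\<And>m. m = i \<or> m = k \<or> m = l"
    using \<open>k \<noteq> i\<close> exhaust_3 by metis
  obtain j where j: "j \<in> multipliers" "half_dist (of_int j * (t * v $ l)) \<le> 7/50"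
    using multiple_back_to_arc [OF at_most] by blast
  obtain m where "m \<noteq> l" "7/50 \<le> half_dist (of_int j * t * v $ m)"
    using two_extremal [of "of_int j * t" l] j(2) by (auto simp: mult.assoc)
  with l [of m] multiple_strictly_inside_arc [OF i j(1)]
    multiple_strictly_inside_arc [OF k j(1)] show False
    by (auto simp: mult.assoc)
qed

lemma seven_fiftieths_not_in_S1_3: "7/50 \<notin> S1 TYPE(3)"
proof
  assume "7/50 \<in> S1 TYPE(3)"
  then obtain T :: "(circle ^ 3) set" where "D T = 7/50" "one_dim_subtorus T" "proper T"
    unfolding S1_def by force
  then obtain v :: "int ^ 3"
    where T: "T = range (\<lambda>t::real. \<chi> i. to_circle (t * of_int (v $ i)))"
    unfolding one_dim_subtorus_def by blast
  have "v $ k \<noteq> 0" for k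
  proof
    assume "v $ k = 0"
    moreover have "to_circle 0 = 0"
      by transfer simp
    ultimately have "x $ k = 0" if "x \<in> T" for x
      using that T by auto
    with \<open>proper T\<close> show False
      unfolding proper_def by blast
  qed
  moreover obtain t :: real where t: "Max (range (\<lambda>i. half_dist (t * v $ i))) = 7/50"
    and minimal: "\<And>s::real. 7/50 \<le> Max (range (\<lambda>i. half_dist (s * v $ i)))"
    using obtain_minimising_time [of v] \<open>D T = 7/50\<close> T by metis
  have "half_dist (t * v $ k) \<le> 7/50" for k
    unfolding t [symmetric] by (rule Max_ge) simp_all
  moreover have "\<exists>k. 7/50 \<le> half_dist (s * v $ k)" for s :: real
    using minimal [of s] by (subst (asm) Max_ge_iff) auto
  ultimately show False
    using no_extremal_time by blast
qed

theorem proposition8p1: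
  shows "7/50 \<in> S0_star TYPE(2) - S1 TYPE(3)"
  using seven_fiftieths_in_S0_star_2 seven_fiftieths_not_in_S1_3 by blast

end
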